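(* Let $b_{0,n}$ be the total number of leaves in all labeled plane 1-2 trees on vertex set $[n]$ ($b_{0,0}=0$), let $B_0(z)=\sum_{n\ge0}b_{0,n}\frac{z^n}{n!}$, and let $B(z)=\sum_{n\ge0}b_n\frac{z^n}{n!}$ where $b_n$ is the number of labeled plane 1-2 trees on $[n]$ and $b_0=1$. Then \[B_0(z)=\frac{6z+\sqrt3\sin(\sqrt3 z)+3\cos(\sqrt3 z)-3}{-3\sqrt3\sin(\sqrt3 z)+3\cos(\sqrt3 z)+6},\] and $B_0$ satisfies $B_0'(z)=2B_0(z)(B(z)-1)+B_0(z)+1$.
   Context: A labeled plane 1-2 tree on vertex set $[n]=\{1,\dots,n\}$ is a rooted tree whose vertices are bijectively labeled by $[n]$, in which every vertex has at most two children, the label of each non-root vertex is less than the label of its parent, and the children of each vertex are linearly ordered (trees differing only in the order of children are distinct). A leaf is a vertex with no children. One has $B(z)=\frac12+\frac{\sqrt3}{2}\tan\left(\frac{\sqrt3}{2}z+\frac{\pi}{6}\right)$. *)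

theory Defs
  imports Complex_Main "HOL-Computational_Algebra.Formal_Power_Series"
begin

text \<open>
  Rooted plane trees with vertices labeled by natural numbers. The tree is nonempty, and the
  order of the list of children is significant.
\<close>

datatype ptree = Node (label: nat) (children: "ptree list")

text \<open>
  The vertices in preorder, each represented by the full subtree rooted at it. This is a list
  rather than a set so that equal subtrees at different positions stay separate.
\<close>

primrec vertices :: "ptree \<Rightarrow> ptree list" where
  "vertices (Node a ts) = Node a ts # concat (map vertices ts)"

definition labels :: "ptree \<Rightarrow> nat list" where
  "labels t = map label (vertices t)"

text \<open>
  Labeled plane 1-2 trees on \<open>{1..n}\<close>. The first two conditions say that labeling is a
  bijection from the vertices to \<open>{1..n}\<close>.
\<close>

definition plane12_trees :: "nat \<Rightarrow> ptree set" where
  "plane12_trees n = {t. distinct (labels t) \<and> set (labels t) = {1..n} \<and>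
     (\<forall>v\<in>set (vertices t). length (children v) \<le> 2 \<and>
        (\<forall>c\<in>set (children v). label c < label v))}"

definition leaves :: "ptree \<Rightarrow> nat" where
  "leaves t = length (filter (\<lambda>v. children v = []) (vertices t))"

text \<open>There is no tree on the empty vertex set, so \<open>b\<^sub>0 = 1\<close> is a convention.\<close>

definition num_trees :: "nat \<Rightarrow> nat" where
  "num_trees n = (if n = 0 then 1 else card (plane12_trees n))"

definition num_leaves :: "nat \<Rightarrow> nat" where
  "num_leaves n = (\<Sum>t\<in>plane12_trees n. leaves t)"

definition B_egf :: "real fps" where
  "B_egf = Abs_fps (\<lambda>n. real (num_trees n) / fact n)"

definition B0_egf :: "real fps" where
  "B0_egf = Abs_fps (\<lambda>n. real (num_leaves n) / fact n)"

text \<open>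
  The set of trees is finite, so \<^const>\<open>card\<close> and \<^const>\<open>sum\<close> above have their
  intended meaning; and there are no trees for \<open>n = 0\<close>, so \<open>b\<^sub>0\<^sub>,\<^sub>0 = 0\<close>.
\<close>

lemma labels_Node: "labels (Node a ts) = a # concat (map labels ts)"
  by (simp add: labels_def[abs_def] map_concat comp_def)

lemma length_labels_pos: "1 \<le> length (labels t)"
  by (cases t) (simp add: labels_Node)

lemma finite_ptrees:
  assumes "finite A"
  shows "finite {t. set (labels t) \<subseteq> A \<and> length (labels t) \<le> k}"
proof (induction k)
  case 0
  have "{t. set (labels t) \<subseteq> A \<and> length (labels t) \<le> 0} = {}"
    using length_labels_pos by (metis (mono_tags, lifting) empty_Collect_eq le_trans not_one_le_zero)
  then show ?case by (metis finite.emptyI)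
next
  case (Suc k)
  let ?T = "\<lambda>k. {t. set (labels t) \<subseteq> A \<and> length (labels t) \<le> k}"
  let ?L = "{ts. set ts \<subseteq> ?T k \<and> length ts \<le> k}"
  have "finite ((\<lambda>(a, ts). Node a ts) ` (A \<times> ?L))"
    by (intro finite_imageI finite_cartesian_product assms finite_lists_length_le Suc)
  moreover have "?T (Suc k) \<subseteq> (\<lambda>(a, ts). Node a ts) ` (A \<times> ?L)"
  proof
    fix t assume t: "t \<in> ?T (Suc k)"
    obtain a ts where teq: "t = Node a ts" by (cases t)
    have sum: "sum_list (map (\<lambda>s. length (labels s)) ts) \<le> k"
      using t by (simp add: teq labels_Node length_concat comp_def)
    have 1: "length (labels s) \<le> k" if "s \<in> set ts" for s
      using member_le_sum_list[of "length (labels s)" "map (\<lambda>s. length (labels s)) ts"] that sum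
      by auto
    have 2: "length ts \<le> k"
      using sum_list_mono[of ts "\<lambda>_. 1::nat" "\<lambda>s. length (labels s)"] length_labels_pos sum
      by (simp add: sum_list_triv)
    have 3: "set (labels s) \<subseteq> A" if "s \<in> set ts" for s
      using t that by (auto simp: teq labels_Node)
    have "a \<in> A" using t by (simp add: teq labels_Node)
    with 1 2 3 have "(a, ts) \<in> A \<times> ?L" by blast
    then show "t \<in> (\<lambda>(a, ts). Node a ts) ` (A \<times> ?L)"
      unfolding teq by (rule rev_image_eqI) simp
  qed
  ultimately show ?case by (rule rev_finite_subset)
qed

lemma finite_plane12_trees: "finite (plane12_trees n)"
proof (rule finite_subset)
  show "plane12_trees n \<subseteq> {t. set (labels t) \<subseteq> {1..n} \<and> length (labels t) \<le> n}"
    using distinct_card by (fastforce simp: plane12_trees_def)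
qed (rule finite_ptrees, simp)

lemma plane12_trees_0: "plane12_trees 0 = {}"
proof -
  have "labels t \<noteq> []" for t using length_labels_pos[of t] by auto
  then show ?thesis by (auto simp: plane12_trees_def)
qed

lemma num_leaves_0: "num_leaves 0 = 0"
  by (simp add: num_leaves_def plane12_trees_0)

end

theory Submission imports Defs
begin

text \<open>
  The root of a tree carries the maximal label, and below it hang no tree, one tree, or an ordered
  pair of trees sharing the remaining labels. By induction on \<open>card A\<close>, the number of trees and
  of leaves on a label set \<open>A\<close> therefore depends only on \<open>card A\<close> (no relabeling bijection is
  needed), and the exponential generating functions satisfy \<open>B' = B\<^sup>2 - B + 1\<close> and the claimed
  equation for \<open>B\<^sub>0\<close>.

  For the closed form \<open>N / D\<close>, observe \<open>N' = D\<close>. Moreover \<open>2 B - 1 = - D' / D\<close>, since both sides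
  solve the same Riccati equation with the same initial value. Hence
  \<open>(B\<^sub>0 D - N)' = B\<^sub>0 ((2 B - 1) D + D') = 0\<close>.
\<close>

unbundle fps_syntax

section \<open>Trees on an arbitrary finite label set\<close>

definition plane12 :: "ptree \<Rightarrow> bool" where
  "plane12 t \<longleftrightarrow> (\<forall>v\<in>set (vertices t). length (children v) \<le> 2 \<and>
     (\<forall>c\<in>set (children v). label c < label v))"

text \<open>Arbitrary label sets are allowed because the subtrees below the root of a tree on
  \<open>{1..n}\<close> can carry labels that do not form an initial interval.\<close>

definition trees_on :: "nat set \<Rightarrow> ptree set" where
  "trees_on A = {t. distinct (labels t) \<and> set (labels t) = A \<and> plane12 t}"

lemma plane12_trees_eq: "plane12_trees n = trees_on {1..n}"
  by (simp add: plane12_trees_def trees_on_def plane12_def)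

lemma finite_trees_on: "finite A \<Longrightarrow> finite (trees_on A)"
proof (rule finite_subset)
  show "trees_on A \<subseteq> {t. set (labels t) \<subseteq> A \<and> length (labels t) \<le> card A}"
    using distinct_card by (fastforce simp: trees_on_def)
qed (rule finite_ptrees)

lemma trees_on_empty: "trees_on {} = {}"
  by (metis atLeastatMost_empty' plane12_trees_0 plane12_trees_eq not_one_le_zero)

lemma trees_on_disjoint: "A \<noteq> B \<Longrightarrow> trees_on A \<inter> trees_on B = {}"
  by (auto simp: trees_on_def)

section \<open>Decomposition at the root\<close>

lemma plane12_Node:
  "plane12 (Node a ts) \<longleftrightarrow> length ts \<le> 2 \<and> (\<forall>c\<in>set ts. label c < a \<and> plane12 c)"
  by (auto simp: plane12_def)

lemma leaves_Node: "leaves (Node a ts) = (if ts = [] then 1 else sum_list (map leaves ts))"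
  by (auto simp: leaves_def[abs_def] filter_concat length_concat comp_def)

lemma label_in_labels: "label t \<in> set (labels t)"
  by (cases t) (simp add: labels_Node)

lemma label_le_root: "plane12 t \<Longrightarrow> x \<in> set (labels t) \<Longrightarrow> x \<le> label t"
proof (induction t)
  case (Node a ts)
  then show ?case by (fastforce simp: labels_Node plane12_Node)
qed

lemma length_le_2_cases:
  assumes "length ts \<le> 2"
  obtains "ts = []" | t where "ts = [t]" | t u where "ts = [t, u]"
  using assms by (cases ts rule: remdups_adj.cases) auto

text \<open>Labels decrease away from the root, so \<open>m\<close> must sit there. The extreme
  choices \<open>X = {}\<close> and \<open>X = M\<close> contribute no pairs, since no tree has an
  empty label set.\<close>

lemma trees_on_insert:
  assumes M: "\<And>x. x \<in> M \<Longrightarrow> x < m"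
  shows "trees_on (insert m M) =
    (if M = {} then {Node m []} else {}) \<union> (\<lambda>t. Node m [t]) ` trees_on M \<union>
    (\<lambda>(t, u). Node m [t, u]) ` (\<Union>X\<in>Pow M. trees_on X \<times> trees_on (M - X))"
    (is "?L = ?R1 \<union> ?R2 \<union> ?R3")
proof (intro equalityI subsetI)
  fix t assume t: "t \<in> ?L"
  obtain a ts where teq: "t = Node a ts" by (cases t)
  have m: "m \<notin> M" using M by blast
  have p: "plane12 (Node a ts)" and d: "distinct (a # concat (map labels ts))"
    and s: "set (a # concat (map labels ts)) = insert m M"
    using t by (auto simp: trees_on_def teq labels_Node)
  \<comment> \<open>The first fact gives \<open>m \<le> a\<close> because the root label is maximal;
    the second gives \<open>a \<le> m\<close>.\<close>
  have "m \<in> set (labels (Node a ts))" "a \<in> insert m M" using s by (auto simp: labels_Node)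
  then have a: "a = m" using label_le_root[OF p] M by fastforce
  have s': "set (concat (map labels ts)) = M"
    using s d m by (auto simp: a)
  from p have "length ts \<le> 2" by (simp add: plane12_Node)
  then show "t \<in> ?R1 \<union> ?R2 \<union> ?R3"
  proof (cases rule: length_le_2_cases)
    case 1
    then show ?thesis using s' by (simp add: teq a)
  next
    case (2 u)
    then have "u \<in> trees_on M" using s' d p by (simp add: trees_on_def plane12_Node)
    then show ?thesis by (auto simp: teq a 2)
  next
    case (3 u v)
    let ?X = "set (labels u)"
    have "u \<in> trees_on ?X" "v \<in> trees_on (M - ?X)" "?X \<subseteq> M"
      using s' d p 3 by (auto simp: trees_on_def plane12_Node)
    then have "(u, v) \<in> (\<Union>X\<in>Pow M. trees_on X \<times> trees_on (M - X))" by blast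
    then have "t \<in> ?R3" by (rule rev_image_eqI) (simp add: teq a 3)
    then show ?thesis by blast
  qed
next
  fix t assume "t \<in> ?R1 \<union> ?R2 \<union> ?R3"
  moreover have "label u < m" if "u \<in> trees_on X" "X \<subseteq> M" for u X
    using label_in_labels[of u] that M by (auto simp: trees_on_def)
  moreover have "m \<notin> M" using M by blast
  ultimately show "t \<in> ?L"
    by (fastforce simp: trees_on_def labels_Node plane12_Node split: if_splits)
qed

text \<open>The three kinds of trees differ in the number of children of the root, and a tree
  determines its label set, so all unions are disjoint. A general \<open>f\<close> serves both
  counts: the constant 1 counts trees, \<open>leaves\<close> counts leaves.\<close>

lemma sum_trees_on_insert:
  fixes f :: "ptree \<Rightarrow> 'a::comm_monoid_add"
  assumes fin: "finite M" and M: "\<And>x. x \<in> M \<Longrightarrow> x < m"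
  shows "(\<Sum>t\<in>trees_on (insert m M). f t) =
    (if M = {} then f (Node m []) else 0) + (\<Sum>t\<in>trees_on M. f (Node m [t])) +
    (\<Sum>X\<in>Pow M. \<Sum>t\<in>trees_on X. \<Sum>u\<in>trees_on (M - X). f (Node m [t, u]))"
proof -
  let ?R1 = "if M = {} then {Node m []} else {}"
  let ?R2 = "(\<lambda>t. Node m [t]) ` trees_on M"
  let ?P = "\<lambda>X. trees_on X \<times> trees_on (M - X)"
  let ?R3 = "(\<lambda>(t, u). Node m [t, u]) ` (\<Union>X\<in>Pow M. ?P X)"
  have finX: "finite (trees_on X)" "finite (trees_on (M - X))" if "X \<in> Pow M" for X
    using that fin by (auto intro!: finite_trees_on dest: finite_subset)
  then have finP: "finite (\<Union>X\<in>Pow M. ?P X)" using fin by blast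
  have "sum f ?R3 = (\<Sum>(t, u)\<in>(\<Union>X\<in>Pow M. ?P X). f (Node m [t, u]))"
    by (subst sum.reindex) (auto simp: inj_on_def case_prod_unfold)
  also have "\<dots> = (\<Sum>X\<in>Pow M. \<Sum>(t, u)\<in>?P X. f (Node m [t, u]))"
    using fin finX trees_on_disjoint by (intro sum.UNION_disjoint) blast+
  also have "\<dots> = (\<Sum>X\<in>Pow M. \<Sum>t\<in>trees_on X. \<Sum>u\<in>trees_on (M - X). f (Node m [t, u]))"
    by (simp add: sum.cartesian_product)
  finally have R3: "sum f ?R3 = \<dots>" .
  have R2: "sum f ?R2 = (\<Sum>t\<in>trees_on M. f (Node m [t]))"
    by (subst sum.reindex) (auto simp: inj_on_def)
  have eq: "trees_on (insert m M) = ?R1 \<union> ?R2 \<union> ?R3"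
    using M by (rule trees_on_insert)
  have "sum f (trees_on (insert m M)) = sum f (?R1 \<union> ?R2) + sum f ?R3"
    unfolding eq using finP finite_trees_on[OF fin] by (intro sum.union_disjoint) auto
  moreover have "sum f (?R1 \<union> ?R2) = sum f ?R1 + sum f ?R2"
    using finite_trees_on[OF fin] by (intro sum.union_disjoint) auto
  ultimately have "sum f (trees_on (insert m M)) = sum f ?R1 + sum f ?R2 + sum f ?R3" by simp
  then show ?thesis by (simp add: R2 R3)
qed

lemma sum_Pow_card:
  fixes h :: "nat \<Rightarrow> 'a::semiring_1"
  assumes "finite M"
  shows "(\<Sum>X\<in>Pow M. h (card X)) = (\<Sum>k\<le>card M. of_nat (card M choose k) * h k)"
proof -
  have "(\<Sum>X\<in>Pow M. h (card X)) = (\<Sum>k\<le>card M. \<Sum>X\<in>{X\<in>Pow M. card X = k}. h (card X))"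
    using assms by (intro sum.group[symmetric]) (auto intro: card_mono)
  also have "\<dots> = (\<Sum>k\<le>card M. of_nat (card M choose k) * h k)"
    using assms by (intro sum.cong refl) (simp add: n_subsets Pow_def)
  finally show ?thesis .
qed

text \<open>\<open>c\<close> and \<open>l\<close> are required to describe the counts on subsets of
  \<open>M\<close> only, so that an induction hypothesis can supply them. The \<open>of_bool\<close>
  terms stem from the one-vertex tree, whose root is a leaf.\<close>

lemma counts_insert:
  fixes c l :: "nat \<Rightarrow> real"
  assumes fin: "finite M" and M: "\<And>x. x \<in> M \<Longrightarrow> x < m"
    and c: "\<And>X. X \<subseteq> M \<Longrightarrow> real (card (trees_on X)) = c (card X)"
    and l: "\<And>X. X \<subseteq> M \<Longrightarrow> (\<Sum>t\<in>trees_on X. real (leaves t)) = l (card X)"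
  shows "real (card (trees_on (insert m M))) = of_bool (card M = 0) + c (card M) +
      (\<Sum>k\<le>card M. real (card M choose k) * (c k * c (card M - k)))" (is ?C)
    and "(\<Sum>t\<in>trees_on (insert m M). real (leaves t)) = of_bool (card M = 0) + l (card M) +
      (\<Sum>k\<le>card M. real (card M choose k) * (l k * c (card M - k) + c k * l (card M - k)))" (is ?L)
proof -
  have d: "card (M - X) = card M - card X" if "X \<subseteq> M" for X
    using that fin by (simp add: card_Diff_subset finite_subset)
  have "(\<Sum>X\<in>Pow M. real (card (trees_on X)) * real (card (trees_on (M - X)))) =
      (\<Sum>X\<in>Pow M. c (card X) * c (card M - card X))"
    by (intro sum.cong refl) (simp add: c d)
  then show ?C
    using sum_trees_on_insert[OF fin M, of "\<lambda>_. 1 :: real"] fin c[of M]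
      sum_Pow_card[OF fin, of "\<lambda>k. c k * c (card M - k)"]
    by simp
  have "(\<Sum>t\<in>trees_on X. \<Sum>u\<in>trees_on (M - X). real (leaves (Node m [t, u]))) =
      l (card X) * c (card M - card X) + c (card X) * l (card M - card X)" if "X \<in> Pow M" for X
  proof -
    \<comment> \<open>Leaves add up over the two subtrees, and each summand is constant in the other
      subtree; hence a leaf sum times a number of trees, twice.\<close>
    have "X \<subseteq> M" using that by simp
    have "(\<Sum>t\<in>trees_on X. \<Sum>u\<in>trees_on (M - X). real (leaves (Node m [t, u]))) =
      (\<Sum>t\<in>trees_on X. real (leaves t)) * real (card (trees_on (M - X))) +
      real (card (trees_on X)) * (\<Sum>u\<in>trees_on (M - X). real (leaves u))"
      by (simp add: leaves_Node sum.distrib sum_distrib_right sum_distrib_left mult.commute)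
    then show ?thesis using \<open>X \<subseteq> M\<close> by (simp only: c l d Diff_subset)
  qed
  then have "(\<Sum>X\<in>Pow M. \<Sum>t\<in>trees_on X. \<Sum>u\<in>trees_on (M - X). real (leaves (Node m [t, u]))) =
      (\<Sum>X\<in>Pow M. l (card X) * c (card M - card X) + c (card X) * l (card M - card X))"
    by (intro sum.cong refl) simp
  then show ?L
    using sum_trees_on_insert[OF fin M, of "\<lambda>t. real (leaves t)"] fin l[of M]
      sum_Pow_card[OF fin, of "\<lambda>k. l k * c (card M - k) + c k * l (card M - k)"]
    by (simp add: leaves_Node)
qed

section \<open>Counts depend only on the size of the label set\<close>

lemma finite_insert_Max_cases:
  fixes A :: "nat set"
  assumes "finite A" "A \<noteq> {}"
  obtains m M where "A = insert m M" "finite M" "\<And>x. x \<in> M \<Longrightarrow> x < m" "card A = Suc (card M)"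
proof
  show "A = insert (Max A) (A - {Max A})" using Max_in[OF assms] by blast
  show "card A = Suc (card (A - {Max A}))" 
    using assms by (metis Max_in card.remove)
  show "x < Max A" if "x \<in> A - {Max A}" for x
    using assms that by (simp add: order_le_neq_trans)
qed (use assms in auto)

definition tree_count :: "nat \<Rightarrow> real" where
  "tree_count n = real (card (plane12_trees n))"

definition leaf_count :: "nat \<Rightarrow> real" where
  "leaf_count n = real (num_leaves n)"

text \<open>Removing the maximum from \<open>A\<close> and from \<open>{1..card A}\<close> leaves
  two sets of equal size, and \<open>counts_insert\<close> expresses both counts through that size
  alone.\<close>

lemma counts_trees_on:
  assumes "finite A"
  shows "real (card (trees_on A)) = tree_count (card A) \<and>
         (\<Sum>t\<in>trees_on A. real (leaves t)) = leaf_count (card A)"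
  using assms
proof (induction "card A" arbitrary: A rule: less_induct)
  case less
  show ?case
  proof (cases "A = {}")
    case True
    then show ?thesis
      by (simp add: trees_on_empty tree_count_def leaf_count_def num_leaves_0 plane12_trees_0)
  next
    case False
    with less(2) obtain m M where A: "A = insert m M" "finite M" "\<And>x. x \<in> M \<Longrightarrow> x < m"
      "card A = Suc (card M)"
      by (metis finite_insert_Max_cases)
    let ?n = "card M"
    \<comment> \<open>Stated for a general \<open>Y\<close>, since it is applied both to
      \<open>M\<close> and to \<open>{1..?n}\<close>.\<close>
    have IH: "real (card (trees_on X)) = tree_count (card X)"
      "(\<Sum>t\<in>trees_on X. real (leaves t)) = leaf_count (card X)"
      if "X \<subseteq> Y" "finite Y" "card Y = ?n" for X Y
    proof -
      have "card X < card A" "finite X"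
        using that A(4) card_mono[of Y X] by (auto simp: finite_subset)
      then show "real (card (trees_on X)) = tree_count (card X)"
        "(\<Sum>t\<in>trees_on X. real (leaves t)) = leaf_count (card X)"
        using less(1) by blast+
    qed
    have I: "{1..Suc ?n} = insert (Suc ?n) {1..?n}" by auto
    have "real (card (trees_on A)) = real (card (trees_on {1..Suc ?n}))"
      "(\<Sum>t\<in>trees_on A. real (leaves t)) = (\<Sum>t\<in>trees_on {1..Suc ?n}. real (leaves t))"
      using counts_insert[of M m tree_count leaf_count] IH[of _ M] A
        counts_insert[of "{1..?n}" "Suc ?n" tree_count leaf_count] IH[of _ "{1..?n}"]
      unfolding I by simp_all
    then show ?thesis
      by (simp add: A(4) tree_count_def leaf_count_def num_leaves_def plane12_trees_eq)
  qed
qed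

lemma counts_Suc:
  "tree_count (Suc n) = of_bool (n = 0) + tree_count n +
     (\<Sum>k\<le>n. real (n choose k) * (tree_count k * tree_count (n - k)))"
  "leaf_count (Suc n) = of_bool (n = 0) + leaf_count n +
     (\<Sum>k\<le>n. real (n choose k) * (leaf_count k * tree_count (n - k) + tree_count k * leaf_count (n - k)))"
proof -
  have I: "{1..Suc n} = insert (Suc n) {1..n}" by auto
  have C: "real (card (trees_on X)) = tree_count (card X)"
    "(\<Sum>t\<in>trees_on X. real (leaves t)) = leaf_count (card X)" if "X \<subseteq> {1..n}" for X
    using counts_trees_on[of X] that by (auto simp: finite_subset)
  note rec = counts_insert[of "{1..n}" "Suc n" tree_count leaf_count, folded I, OF _ _ C]
  show "tree_count (Suc n) = of_bool (n = 0) + tree_count n +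
     (\<Sum>k\<le>n. real (n choose k) * (tree_count k * tree_count (n - k)))"
    using rec(1) counts_trees_on[of "{1..Suc n}"] by simp
  show "leaf_count (Suc n) = of_bool (n = 0) + leaf_count n +
     (\<Sum>k\<le>n. real (n choose k) * (leaf_count k * tree_count (n - k) + tree_count k * leaf_count (n - k)))"
    using rec(2) counts_trees_on[of "{1..Suc n}"] by simp
qed

section \<open>Exponential generating functions and their differential equations\<close>

definition egf :: "(nat \<Rightarrow> real) \<Rightarrow> real fps" where
  "egf a = Abs_fps (\<lambda>n. a n / fact n)"

lemma egf_mult_nth:
  "(egf a * egf b) $ n = (\<Sum>k\<le>n. real (n choose k) * (a k * b (n - k))) / fact n"
  unfolding fps_mult_nth sum_divide_distrib atMost_atLeast0
  by (intro sum.cong refl) (simp add: egf_def binomial_fact)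

lemma egf_deriv_nth: "fps_deriv (egf a) $ n = a (Suc n) / fact n"
  by (simp add: egf_def divide_simps del: of_nat_Suc)

lemma egf_nth: "egf a $ n = a n / fact n"
  by (simp add: egf_def)

text \<open>The summand 1 is the convention for the empty vertex set:
  \<open>tree_count 0 = 0\<close>, but \<open>num_trees 0 = 1\<close>.\<close>

lemma B_egf_eq: "B_egf = 1 + egf tree_count"
  by (rule fps_ext)
    (simp add: B_egf_def num_trees_def egf_def tree_count_def plane12_trees_0)

lemma B0_egf_eq: "B0_egf = egf leaf_count"
  by (rule fps_ext) (simp add: B0_egf_def egf_def leaf_count_def)

lemma B_egf_deriv: "fps_deriv B_egf = B_egf\<^sup>2 - B_egf + 1"
proof -
  have "fps_deriv (egf tree_count) = 1 + egf tree_count + egf tree_count * egf tree_count"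
    by (rule fps_ext)
      (simp add: egf_deriv_nth egf_mult_nth egf_nth counts_Suc add_divide_distrib del: fps_deriv_nth)
  then show ?thesis by (simp add: B_egf_eq power2_eq_square algebra_simps)
qed

lemma B0_egf_deriv: "fps_deriv B0_egf = 2 * B0_egf * (B_egf - 1) + B0_egf + 1"
proof -
  have "fps_deriv (egf leaf_count) = 1 + egf leaf_count +
      (egf leaf_count * egf tree_count + egf tree_count * egf leaf_count)"
    by (rule fps_ext)
      (simp only: egf_deriv_nth egf_mult_nth egf_nth fps_add_nth fps_one_nth counts_Suc
        add_divide_distrib distrib_left sum.distrib, simp)
  then show ?thesis by (simp add: B_egf_eq B0_egf_eq algebra_simps)
qed

section \<open>Uniqueness of solutions and the closed form\<close>

text \<open>Coefficient \<open>k\<close> of the equation expresses \<open>f $ Suc k\<close> through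
  \<open>f $ 0\<close>, ..., \<open>f $ k\<close>, which all vanish by induction. As
  \<open>g\<close> is arbitrary, it may itself involve \<open>f\<close>.\<close>

lemma fps_linear_ode_zero:
  fixes f g :: "'a::field_char_0 fps"
  assumes "fps_deriv f = f * g" "f $ 0 = 0"
  shows "f = 0"
proof (rule fps_ext)
  fix n show "f $ n = 0 $ n"
  proof (induction n rule: less_induct)
    case (less n)
    show ?case
    proof (cases n)
      case 0
      then show ?thesis using assms(2) by simp
    next
      case (Suc k)
      have "fps_deriv f $ k = (\<Sum>i=0..k. f $ i * g $ (k - i))"
        by (simp add: assms(1) fps_mult_nth)
      also have "\<dots> = 0" using less Suc by (intro sum.neutral) simp
      finally show ?thesis by (simp add: Suc del: of_nat_Suc)
    qed
  qed
qed

theorem theorem3p1: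
  "B0_egf =
      (6 * fps_X + fps_const (sqrt 3) * fps_sin (sqrt 3) + 3 * fps_cos (sqrt 3) - 3) /
      (- 3 * fps_const (sqrt 3) * fps_sin (sqrt 3) + 3 * fps_cos (sqrt 3) + 6) \<and>
   fps_deriv B0_egf = 2 * B0_egf * (B_egf - 1) + B0_egf + 1"
proof
  define r s c :: "real fps" where "r = fps_const (sqrt 3)"
    and "s = fps_sin (sqrt 3)" and "c = fps_cos (sqrt 3)"
  define N D where "N = 6 * fps_X + r * s + 3 * c - 3" and "D = - 3 * r * s + 3 * c + 6"
  have rr: "r * r = 3" by (simp add: r_def numeral_fps_const)
  have sc: "s * s + c * c = 1"
    using fps_sin_cos_sum_of_squares[of "sqrt 3"] by (simp add: s_def c_def power2_eq_square add.commute)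
  have dr: "fps_deriv r = 0" and ds: "fps_deriv s = r * c" and dc: "fps_deriv c = - r * s"
    by (simp_all add: r_def s_def c_def fps_sin_deriv fps_cos_deriv flip: fps_const_neg)
  have dN: "fps_deriv N = D"
  proof -
    have "fps_deriv N = 6 + r * r * c - 3 * r * s" 
      by (simp add: N_def dr ds dc algebra_simps)
    then show ?thesis by (simp add: rr D_def)
  qed
  have dD: "fps_deriv D = - 9 * c - 3 * r * s"
  proof -
    have "fps_deriv D = - 3 * (r * r) * c - 3 * r * s"
      by (simp add: D_def dr ds dc algebra_simps)
    then show ?thesis by (simp add: rr)
  qed
  have ddD: "fps_deriv (fps_deriv D) = 18 - 3 * D"
  proof -
    have "fps_deriv (fps_deriv D) = 9 * r * s - 3 * (r * r) * c"
      unfolding dD by (simp add: dr ds dc algebra_simps)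
    then show ?thesis by (simp add: rr D_def)
  qed
  \<comment> \<open>This is a first integral of \<open>ddD\<close>: multiply by
    \<open>2 * D'\<close> and integrate. Together they give
    \<open>3 * D * D + 2 * D * D'' = D' * D'\<close>, which is what remains of the equation for
    \<open>W\<close> below after inserting \<open>B' = B * B - B + 1\<close> and cancelling.\<close>
  have sq: "(fps_deriv D) * fps_deriv D = 36 * D - 3 * D * D"
  proof -
    have "fps_deriv D * fps_deriv D - (36 * D - 3 * D * D) =
        108 * (s * s + c * c - 1) + 36 * (s * s) * (r * r - 3)"
      unfolding dD unfolding D_def by (simp add: algebra_simps)
    then show ?thesis by (simp add: rr sc)
  qed
  have D0: "D $ 0 = 9" by (simp add: D_def s_def c_def fps_sin_nth_0 fps_cos_nth_0)
  then have Dnz: "D \<noteq> 0" by auto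
  \<comment> \<open>\<open>W\<close> is \<open>D\<close> times the difference of the two Riccati solutions, so it satisfies \<open>W' = W \<cdot> W / (2 D)\<close>.\<close>
  define W where "W = (2 * B_egf - 1) * D + fps_deriv D"
  have "2 * D * fps_deriv W = W * W"
    using ddD sq B_egf_deriv unfolding W_def power2_eq_square
    by (simp, algebra)
  moreover have "2 * D * inverse (2 * D) = 1"
    by (rule inverse_mult_eq_1') (simp add: D0 numeral_fps_const)
  \<comment> \<open>The quadratic equation is read as a linear one whose coefficient contains
    \<open>W\<close>.\<close>
  ultimately have "fps_deriv W = W * (W * inverse (2 * D))" by algebra
  \<comment> \<open>Here \<open>B_egf $ 0 = 1\<close>, \<open>D $ 0 = 9\<close> and
    \<open>fps_deriv D $ 0 = -9\<close>; the convention for the empty vertex set thus fixes the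
    initial value.\<close>
  moreover have "W $ 0 = 0"
    by (simp add: W_def dD D0 B_egf_def num_trees_def s_def c_def)
  ultimately have "W = 0" by (rule fps_linear_ode_zero)
  have "fps_deriv (B0_egf * D - N) = 0"
    using B0_egf_deriv \<open>W = 0\<close> unfolding W_def
    by (simp add: dN, algebra)
  moreover have "(B0_egf * D - N) $ 0 = 0" 
    by (simp add: N_def s_def c_def B0_egf_def num_leaves_0)
  \<comment> \<open>The uniqueness lemma is used with \<open>g = 0\<close>: zero derivative and zero
    constant term.\<close>
  ultimately have "B0_egf * D = N"
    by (metis eq_iff_diff_eq_0 fps_linear_ode_zero mult_zero_right)
  then show "B0_egf =
      (6 * fps_X + fps_const (sqrt 3) * fps_sin (sqrt 3) + 3 * fps_cos (sqrt 3) - 3) /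
      (- 3 * fps_const (sqrt 3) * fps_sin (sqrt 3) + 3 * fps_cos (sqrt 3) + 6)"
    using Dnz unfolding N_def D_def r_def s_def c_def by (metis nonzero_mult_div_cancel_right)
qed (rule B0_egf_deriv)

end
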